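(* There exist a nonlinearity $f\in C^1(\mathbb{R})$ and a number $N\in\mathbb{N}$ such that, for each integer $n\ge N$, there exist a closed surface $M$ of genus $1$, properly embedded in $\mathbb{R}^3$ and equipped with the Riemannian metric $g$ induced from $\mathbb{R}^3$, and a pattern $U$ of the reaction-diffusion equation $$\partial_t u=\Delta_g u+f(u)\quad\text{in } M\times(0,\infty),$$ such that $U$ has at least $4n$ critical points.
   Context: $\Delta_g$ denotes the Laplace–Beltrami operator of $(M,g)$. A stationary solution $U$ (a function on $M$ with $\Delta_g U+f(U)=0$) is called stable (in the sense of Lyapunov) if for every $\epsilon>0$ there exists $\delta>0$ such that for every initial datum $u_0$ with $\|u_0-U\|_{\infty}<\delta$ the solution $u$ with $u(\cdot,0)=u_0$ satisfies $\|u(\cdot,t)-U\|_\infty<\epsilon$ for every $t>0$. A pattern is a stable nonconstant stationary solution. *)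

theory Defs
  imports "HOL-Analysis.Analysis"
begin

fun Ck :: "nat \<Rightarrow> 'a::real_normed_vector set \<Rightarrow> ('a \<Rightarrow> 'b::real_normed_vector) \<Rightarrow> bool" where
  "Ck 0 S F = continuous_on S F"
| "Ck (Suc k) S F = (\<exists>F'. (\<forall>x\<in>S. (F has_derivative F' x) (at x)) \<and> (\<forall>v. Ck k S (\<lambda>x. F' x v)))"

definition smooth :: "('a::real_normed_vector \<Rightarrow> 'b::real_normed_vector) \<Rightarrow> bool" where
  "smooth F \<longleftrightarrow> (\<forall>k. Ck k UNIV F)"

definition coordvec :: "nat \<Rightarrow> real \<times> real" where
  "coordvec i = (if i = 0 then (1, 0) else (0, 1))"

definition pd :: "nat \<Rightarrow> (real \<times> real \<Rightarrow> 'b::real_normed_vector) \<Rightarrow> real \<times> real \<Rightarrow> 'b" where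
  "pd i F p = frechet_derivative F (at p) (coordvec i)"

text \<open>A closed surface of genus 1 embedded in R^3, given by a smooth doubly 1-periodic
  immersion X of the plane which is injective modulo Z^2; the surface is range X.\<close>
definition torus_param :: "(real \<times> real \<Rightarrow> real^3) \<Rightarrow> bool" where
  "torus_param X \<longleftrightarrow>
     smooth X \<and>
     (\<forall>s t. X (s + 1, t) = X (s, t) \<and> X (s, t + 1) = X (s, t)) \<and>
     (\<forall>p q. X p = X q \<longrightarrow> fst p - fst q \<in> \<int> \<and> snd p - snd q \<in> \<int>) \<and>
     (\<forall>p. inj (frechet_derivative X (at p)))"

definition gmet :: "(real \<times> real \<Rightarrow> real^3) \<Rightarrow> nat \<Rightarrow> nat \<Rightarrow> real \<times> real \<Rightarrow> real" where
  "gmet X i j p = pd i X p \<bullet> pd j X p"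

definition gdet :: "(real \<times> real \<Rightarrow> real^3) \<Rightarrow> real \<times> real \<Rightarrow> real" where
  "gdet X p = gmet X 0 0 p * gmet X 1 1 p - gmet X 0 1 p * gmet X 1 0 p"

definition ginv :: "(real \<times> real \<Rightarrow> real^3) \<Rightarrow> nat \<Rightarrow> nat \<Rightarrow> real \<times> real \<Rightarrow> real" where
  "ginv X i j p =
     (if i = 0 \<and> j = 0 then gmet X 1 1 p
      else if i = 1 \<and> j = 1 then gmet X 0 0 p
      else - gmet X i j p) / gdet X p"

text \<open>Laplace-Beltrami operator in local coordinates, applied to w = U o X:
  (1/sqrt g) d_i (sqrt g g^{ij} d_j w).\<close>
definition LB :: "(real \<times> real \<Rightarrow> real^3) \<Rightarrow> (real \<times> real \<Rightarrow> real) \<Rightarrow> real \<times> real \<Rightarrow> real" where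
  "LB X w p = (1 / sqrt (gdet X p)) *
     (\<Sum>i\<in>{0,1::nat}. pd i (\<lambda>q. sqrt (gdet X q) * (\<Sum>j\<in>{0,1::nat}. ginv X i j q * pd j w q)) p)"

text \<open>U (a function on M = range X, represented on R^3) is a stationary solution.\<close>
definition stationary :: "(real \<Rightarrow> real) \<Rightarrow> (real \<times> real \<Rightarrow> real^3) \<Rightarrow> (real^3 \<Rightarrow> real) \<Rightarrow> bool" where
  "stationary f X U \<longleftrightarrow> Ck 2 UNIV (U \<circ> X) \<and> (\<forall>p. LB X (U \<circ> X) p + f (U (X p)) = 0)"

definition rd_solution :: "(real \<Rightarrow> real) \<Rightarrow> (real \<times> real \<Rightarrow> real^3) \<Rightarrow> real \<Rightarrow> (real^3 \<Rightarrow> real \<Rightarrow> real) \<Rightarrow> bool" where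
  "rd_solution f X T u \<longleftrightarrow>
     continuous_on (range X \<times> {0..<T}) (\<lambda>(x, t). u x t) \<and>
     (\<forall>t\<in>{0<..<T}. Ck 2 UNIV (\<lambda>q. u (X q) t)) \<and>
     (\<forall>t\<in>{0<..<T}. \<forall>p. ((\<lambda>s. u (X p) s) has_real_derivative
         (LB X (\<lambda>q. u (X q) t) p + f (u (X p) t))) (at t))"

text \<open>Lyapunov stability in the sup norm over M (sup norms of continuous functions on the
  compact M are maxima, so strict sup bounds are pointwise strict bounds).\<close>
definition stable :: "(real \<Rightarrow> real) \<Rightarrow> (real \<times> real \<Rightarrow> real^3) \<Rightarrow> (real^3 \<Rightarrow> real) \<Rightarrow> bool" where
  "stable f X U \<longleftrightarrow>
     (\<forall>\<epsilon>>0. \<exists>\<delta>>0. \<forall>T u. T > 0 \<longrightarrow> rd_solution f X T u \<longrightarrow>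
        (\<forall>x\<in>range X. \<bar>u x 0 - U x\<bar> < \<delta>) \<longrightarrow>
        (\<forall>t\<in>{0<..<T}. \<forall>x\<in>range X. \<bar>u x t - U x\<bar> < \<epsilon>))"

definition pattern :: "(real \<Rightarrow> real) \<Rightarrow> (real \<times> real \<Rightarrow> real^3) \<Rightarrow> (real^3 \<Rightarrow> real) \<Rightarrow> bool" where
  "pattern f X U \<longleftrightarrow> stationary f X U \<and> stable f X U \<and>
     (\<exists>x\<in>range X. \<exists>y\<in>range X. U x \<noteq> U y)"

definition critical_points :: "(real \<times> real \<Rightarrow> real^3) \<Rightarrow> (real^3 \<Rightarrow> real) \<Rightarrow> (real^3) set" where
  "critical_points X U = {X p | p. pd 0 (U \<circ> X) p = 0 \<and> pd 1 (U \<circ> X) p = 0}"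

end

theory Submission
  imports Defs
begin

text \<open>
  One torus of revolution serves all \<open>n\<close>: a pattern that depends only on the latitude has whole
  circles of critical points. On the torus with radii \<open>4\<close> and \<open>1\<close> put \<open>c = cos (2 * pi * s)\<close>, and
  let \<open>U\<close> be an increasing function of \<open>c\<close> with Gaussian derivative, that is, a steep front
  located at \<open>c = -2/5\<close>. There the geodesic curvature of the parallels increases with the distance
  from the inner equator, which makes the position of the front stable. Since \<open>U\<close> is injective in
  \<open>c\<close>, the equation itself defines the nonlinearity on the range of \<open>U\<close>, and it extends to a
  \<open>C\<^sup>1\<close> function on the line.

  Stability follows from an explicit positive function \<open>\<phi>\<close> (the exponential of a cubic in \<open>c\<close>) with
  \<open>\<Delta>\<phi> + f'(U)\<phi> < 0\<close>: then \<open>U + h\<phi>\<close> and \<open>U - h\<phi>\<close> are a strict super- and a strict subsolution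
  for small \<open>h > 0\<close>, and a solution starting between them can never touch them.
\<close>

section \<open>Smoothness and partial derivatives\<close>

lemma Ck_add:
  assumes "Ck k S F" "Ck k S G" shows "Ck k S (\<lambda>x. F x + G x)"
  using assms
proof (induction k arbitrary: F G)
  case 0
  then show ?case by (auto intro: continuous_on_add)
next
  case (Suc k)
  then obtain F' G' where
    "\<forall>x\<in>S. (F has_derivative F' x) (at x)" "\<forall>v. Ck k S (\<lambda>x. F' x v)"
    "\<forall>x\<in>S. (G has_derivative G' x) (at x)" "\<forall>v. Ck k S (\<lambda>x. G' x v)"
    by auto
  then have "\<forall>x\<in>S. ((\<lambda>x. F x + G x) has_derivative (\<lambda>v. F' x v + G' x v)) (at x)"
    "\<forall>v. Ck k S (\<lambda>x. F' x v + G' x v)"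
    using Suc.IH by (auto intro: has_derivative_add)
  then show ?case by (auto intro!: exI[of _ "\<lambda>x v. F' x v + G' x v"])
qed

text \<open>Differentiation shifts the phase by \<open>pi/2\<close> and contributes the constant
  \<open>l v\<close>, which the vector absorbs. The family is thus closed under directional
  derivatives, hence the induction over arbitrary \<open>\<alpha>\<close> and
  \<open>w\<close>.\<close>

lemma Ck_sin_linear:
  fixes l :: "'a::real_normed_vector \<Rightarrow> real" and w :: "'b::real_normed_vector"
  assumes "bounded_linear l"
  shows "Ck k S (\<lambda>x. sin (l x + \<alpha>) *\<^sub>R w)"
proof (induction k arbitrary: \<alpha> w)
  case 0
  show ?case
    unfolding Ck.simps
    by (intro continuous_intros bounded_linear.continuous_on[OF assms])
next
  case (Suc k)
  have "((\<lambda>x. sin (l x + \<alpha>) *\<^sub>R w) has_derivative (\<lambda>v. sin (l x + (\<alpha> + pi/2)) *\<^sub>R (l v *\<^sub>R w))) (at x)" for x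
    by (auto intro!: derivative_eq_intros bounded_linear_imp_has_derivative[OF assms]
        simp: sin_add cos_add algebra_simps)
  then show ?case
    using Suc.IH
    by (auto intro!: exI[of _ "\<lambda>x v. sin (l x + (\<alpha> + pi/2)) *\<^sub>R (l v *\<^sub>R w)"])
qed

lemma Ck_2_fst:
  fixes W W' W'' :: "real \<Rightarrow> real"
  assumes "\<And>s. (W has_real_derivative W' s) (at s)" "\<And>s. (W' has_real_derivative W'' s) (at s)"
    and "continuous_on UNIV W''"
  shows "Ck 2 UNIV (\<lambda>p::real \<times> real. W (fst p))"
proof -
  have 1: "((\<lambda>p::real \<times> real. W (fst p)) has_derivative (\<lambda>v. W' (fst p) * fst v)) (at p)" for p
    using has_derivative_compose[OF has_derivative_fst[OF has_derivative_ident]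
        assms(1)[of "fst p", unfolded has_field_derivative_def]] by simp
  have 2: "((\<lambda>p::real \<times> real. W' (fst p) * fst v) has_derivative (\<lambda>u. W'' (fst p) * fst u * fst v)) (at p)" for p v
    using has_derivative_mult_left[OF has_derivative_compose[OF has_derivative_fst[OF has_derivative_ident]
        assms(2)[of "fst p", unfolded has_field_derivative_def]]] by simp
  have 3: "continuous_on UNIV (\<lambda>p::real \<times> real. W'' (fst p) * fst u * fst v)" for u v :: "real \<times> real"
    by (intro continuous_intros continuous_on_compose2[OF assms(3)]) auto
  have "Ck 1 UNIV (\<lambda>p::real \<times> real. W' (fst p) * fst v)" for v :: "real \<times> real"
    unfolding One_nat_def Ck.simps using 2 3
    by (intro exI[of _ "\<lambda>p u. W'' (fst p) * fst u * fst v"]) blast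
  then show ?thesis
    unfolding numeral_2_eq_2 Ck.simps(2)[of "Suc 0"] using 1
    by (intro exI[of _ "\<lambda>p v. W' (fst p) * fst v"]) (simp del: Ck.simps)
qed

lemma pd_eq: "(F has_derivative D) (at p) \<Longrightarrow> pd i F p = D (coordvec i)"
  unfolding pd_def by (metis frechet_derivative_at)

text \<open>Restricting the Frechet derivative to coordinate lines makes one-variable calculus, in
  particular the second derivative test, available for \<open>pd\<close>.\<close>

lemma pd_partial:
  fixes F :: "real \<times> real \<Rightarrow> real"
  assumes "F differentiable (at (s, t))"
  shows "((\<lambda>x. F (x, t)) has_real_derivative pd 0 F (s, t)) (at s)"
    and "((\<lambda>x. F (s, x)) has_real_derivative pd 1 F (s, t)) (at t)"
proof -
  define D where "D = frechet_derivative F (at (s, t))"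
  have D: "(F has_derivative D) (at (s, t))"
    using assms unfolding D_def by (simp add: frechet_derivative_works)
  then interpret bounded_linear D by (rule has_derivative_bounded_linear)
  have "((\<lambda>x. F (x, t)) has_derivative (\<lambda>h. D (h, 0))) (at s)"
    by (rule has_derivative_compose[of "\<lambda>x. (x, t)" "\<lambda>h. (h, 0)", OF _ D])
      (auto intro!: derivative_eq_intros)
  moreover have "(\<lambda>h. D (h, 0)) = (\<lambda>h. h *\<^sub>R D (1, 0))"
    proof
    fix h show "D (h, 0) = h *\<^sub>R D (1, 0)" using scaleR[of h "(1, 0)"] by simp
  qed
  ultimately show "((\<lambda>x. F (x, t)) has_real_derivative pd 0 F (s, t)) (at s)"
    unfolding has_real_derivative_iff_has_vector_derivative has_vector_derivative_def pd_eq[OF D] coordvec_def by simp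
  have "((\<lambda>x. F (s, x)) has_derivative (\<lambda>h. D (0, h))) (at t)"
    by (rule has_derivative_compose[of "\<lambda>x. (s, x)" "\<lambda>h. (0, h)", OF _ D])
      (auto intro!: derivative_eq_intros)
  moreover have "(\<lambda>h. D (0, h)) = (\<lambda>h. h *\<^sub>R D (0, 1))"
    proof
    fix h show "D (0, h) = h *\<^sub>R D (0, 1)" using scaleR[of h "(0, 1)"] by simp
  qed
  ultimately show "((\<lambda>x. F (s, x)) has_real_derivative pd 1 F (s, t)) (at t)"
    unfolding has_real_derivative_iff_has_vector_derivative has_vector_derivative_def pd_eq[OF D] coordvec_def by simp
qed

lemma Ck_2_differentiable:
  assumes "Ck 2 UNIV F"
  shows "F differentiable (at p)" and "pd i F differentiable (at p)"
proof -
  obtain F' where F': "\<And>x. (F has_derivative F' x) (at x)" "\<And>v. Ck (Suc 0) UNIV (\<lambda>x. F' x v)"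
    using assms unfolding numeral_2_eq_2 Ck.simps(2)[of "Suc 0"] by auto
  show "F differentiable (at p)"
    using F'(1) differentiable_def by blast
  have "pd i F = (\<lambda>x. F' x (coordvec i))"
    using pd_eq[OF F'(1)] by auto
  then show "pd i F differentiable (at p)"
    using F'(2)[of "coordvec i"] unfolding Ck.simps differentiable_def \<open>pd i F = _\<close> by blast
qed

section \<open>The torus of revolution\<close>

definition ring_torus :: "real \<times> real \<Rightarrow> real^3" where
  "ring_torus p = ((4 + cos (2 * pi * fst p)) * cos (2 * pi * snd p)) *\<^sub>R axis 1 1
     + ((4 + cos (2 * pi * fst p)) * sin (2 * pi * snd p)) *\<^sub>R axis 2 1
     + sin (2 * pi * fst p) *\<^sub>R axis 3 1"

lemma ring_torus_components:
  "ring_torus (s, t) $ 1 = (4 + cos (2 * pi * s)) * cos (2 * pi * t)"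
  "ring_torus (s, t) $ 2 = (4 + cos (2 * pi * s)) * sin (2 * pi * t)"
  "ring_torus (s, t) $ 3 = sin (2 * pi * s)"
  by (simp_all add: ring_torus_def axis_def)

lemma four_plus_cos_pos: "4 + cos (x::real) > 0"
  using cos_ge_minus_one[of x] by linarith

lemma smooth_ring_torus: "smooth ring_torus"
  unfolding smooth_def
proof
  fix k
  define l where "l m n = (\<lambda>p::real \<times> real. 2 * pi * (m * fst p + n * snd p))" for m n :: real
  have l: "bounded_linear (l m n)" for m n
    unfolding l_def by (intro bounded_linear_intros)
  let ?S = "\<lambda>m n \<alpha> w p. sin (l m n p + \<alpha>) *\<^sub>R w :: real^3"
  \<comment> \<open>Product-to-sum formulas turn each coordinate into a sum of sines of linear
    phases; a shift by \<open>pi/2\<close> stands for a cosine.\<close>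
  have eq: "ring_torus = (\<lambda>p. ?S 0 1 (pi/2) (axis 1 4) p
      + ?S 1 1 (pi/2) (axis 1 (1/2)) p + ?S 1 (-1) (pi/2) (axis 1 (1/2)) p
      + ?S 0 1 0 (axis 2 4) p + ?S 1 1 0 (axis 2 (1/2)) p + ?S (-1) 1 0 (axis 2 (1/2)) p
      + ?S 1 0 0 (axis 3 1) p)"
  proof (rule ext)
    fix p :: "real \<times> real"
    show "ring_torus p = ?S 0 1 (pi/2) (axis 1 4) p
      + ?S 1 1 (pi/2) (axis 1 (1/2)) p + ?S 1 (-1) (pi/2) (axis 1 (1/2)) p
      + ?S 0 1 0 (axis 2 4) p + ?S 1 1 0 (axis 2 (1/2)) p + ?S (-1) 1 0 (axis 2 (1/2)) p
      + ?S 1 0 0 (axis 3 1) p"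
      unfolding vec_eq_iff forall_3
      by (cases p, simp add: ring_torus_components axis_def l_def ring_distribs
          sin_add cos_add sin_diff cos_diff, simp add: field_simps)
  qed
  show "Ck k UNIV ring_torus"
    unfolding eq by (intro Ck_add Ck_sin_linear l)
qed

lemma has_derivative_ring_torus:
  "(ring_torus has_derivative (\<lambda>h.
      (2 * pi * ((4 + cos (2 * pi * s)) * (- sin (2 * pi * t) * snd h) - sin (2 * pi * s) * fst h * cos (2 * pi * t)))
        *\<^sub>R axis 1 1
    + (2 * pi * ((4 + cos (2 * pi * s)) * (cos (2 * pi * t) * snd h) - sin (2 * pi * s) * fst h * sin (2 * pi * t)))
        *\<^sub>R axis 2 1
    + (2 * pi * (cos (2 * pi * s) * fst h)) *\<^sub>R axis 3 1)) (at (s, t))"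
  unfolding ring_torus_def[abs_def]
  by (intro has_derivative_add has_derivative_scaleR_left)
    (auto intro!: derivative_eq_intros simp: algebra_simps)

lemma ring_torus_eqD:
  assumes "ring_torus p = ring_torus q"
  shows "fst p - fst q \<in> \<int>" and "snd p - snd q \<in> \<int>"
proof -
  obtain s t s' t' where pq: "p = (s, t)" "q = (s', t')"
    by fastforce
  let ?r = "4 + cos (2 * pi * s)" and ?r' = "4 + cos (2 * pi * s')"
  have eqs: "?r * cos (2 * pi * t) = ?r' * cos (2 * pi * t')"
    "?r * sin (2 * pi * t) = ?r' * sin (2 * pi * t')" "sin (2 * pi * s) = sin (2 * pi * s')"
    using assms unfolding pq by (metis ring_torus_components)+
  \<comment> \<open>The distance to the axis is positive, so its square, read off from the first two
    coordinates, determines it. Dividing by it leaves the cosine and sine of the second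
    angle.\<close>
  have sq: "(x * cos y)\<^sup>2 + (x * sin y)\<^sup>2 = x\<^sup>2" for x y :: real
    by (simp add: power_mult_distrib flip: distrib_left)
  have "?r\<^sup>2 = ?r'\<^sup>2"
    using sq[of ?r "2 * pi * t"] sq[of ?r' "2 * pi * t'"] unfolding eqs(1,2) by simp
  then have r: "?r = ?r'"
    using four_plus_cos_pos by (simp add: power2_eq_iff_nonneg less_imp_le)
  have "cos (2 * pi * s) = cos (2 * pi * s')"
    using r by simp
  then obtain m :: int where m: "2 * pi * s = 2 * pi * s' + 2 * pi * m"
    using eqs(3) by (metis sin_cos_eq_iff)
  have "cos (2 * pi * t) = cos (2 * pi * t')" "sin (2 * pi * t) = sin (2 * pi * t')"
    using eqs(1,2) four_plus_cos_pos[of "2 * pi * s'"] unfolding r by auto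
  then obtain n :: int where n: "2 * pi * t = 2 * pi * t' + 2 * pi * n"
    by (metis sin_cos_eq_iff)
  have "s = s' + m" "t = t' + n"
    using m n by (simp_all flip: distrib_left)
  then show "fst p - fst q \<in> \<int>" "snd p - snd q \<in> \<int>"
    unfolding pq by simp_all
qed

lemma torus_param_ring_torus: "torus_param ring_torus"
  unfolding torus_param_def
proof (intro conjI allI impI)
  fix s t :: real
  show "ring_torus (s + 1, t) = ring_torus (s, t)" "ring_torus (s, t + 1) = ring_torus (s, t)"
    by (simp_all add: ring_torus_def distrib_left)
next
  fix p :: "real \<times> real"
  obtain s t where p: "p = (s, t)" by fastforce
  let ?D = "frechet_derivative ring_torus (at p)"
  have D: "(ring_torus has_derivative ?D) (at p)"
    unfolding p frechet_derivative_works[symmetric]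
    by (rule differentiableI[OF has_derivative_ring_torus])
  have "h = 0" if "?D h = 0" for h
  proof -
    let ?r = "4 + cos (2 * pi * s)"
    have "?D h $ 1 = 0" "?D h $ 2 = 0" "?D h $ 3 = 0"
      using that by simp_all
    then have z: "?r * (- sin (2 * pi * t) * snd h) - sin (2 * pi * s) * fst h * cos (2 * pi * t) = 0"
      "?r * (cos (2 * pi * t) * snd h) - sin (2 * pi * s) * fst h * sin (2 * pi * t) = 0"
      "cos (2 * pi * s) * fst h = 0"
      unfolding p frechet_derivative_at[OF has_derivative_ring_torus, symmetric]
      by (simp_all add: axis_def)
    \<comment> \<open>The two horizontal components are the pair \<open>(- u, r * y)\<close> rotated
      by the second angle, so their squares add up to a sum free of that angle.\<close>
    have id: "(r * (- S * y) - u * C)\<^sup>2 + (r * (C * y) - u * S)\<^sup>2 = (C\<^sup>2 + S\<^sup>2) * ((r * y)\<^sup>2 + u\<^sup>2)"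
      for r S C y u :: real
      by (simp add: power2_eq_square algebra_simps)
    have "(?r * snd h)\<^sup>2 + (sin (2 * pi * s) * fst h)\<^sup>2 = 0"
      using id[of ?r "sin (2 * pi * t)" "snd h" "sin (2 * pi * s) * fst h" "cos (2 * pi * t)"]
      unfolding z by simp
    then have "?r * snd h = 0" "sin (2 * pi * s) * fst h = 0"
      by (simp_all add: sum_power2_eq_zero_iff)
    then have "snd h = 0" "fst h = 0"
      using four_plus_cos_pos[of "2 * pi * s"] z(3) sin_zero_norm_cos_one[of "2 * pi * s"] by auto
    then show "h = 0"
      by (simp add: prod_eq_iff)
  qed
  then show "inj ?D"
    using linear_injective_0[OF has_derivative_linear[OF D]] by blast
qed (auto simp: smooth_ring_torus dest: ring_torus_eqD)

lemma gmet_ring_torus: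
  "gmet ring_torus 0 0 (s, t) = (2 * pi)\<^sup>2"
  "gmet ring_torus 0 1 (s, t) = 0" "gmet ring_torus 1 0 (s, t) = 0"
  "gmet ring_torus 1 1 (s, t) = (2 * pi)\<^sup>2 * (4 + cos (2 * pi * s))\<^sup>2"
proof -
  note simps = gmet_def pd_eq[OF has_derivative_ring_torus] coordvec_def inner_vec_def sum_3 axis_def
  show "gmet ring_torus 0 1 (s, t) = 0" "gmet ring_torus 1 0 (s, t) = 0"
    by (simp_all add: simps algebra_simps)
  have "gmet ring_torus 0 0 (s, t) = (2 * pi)\<^sup>2 * ((sin (2 * pi * s))\<^sup>2 *
      ((sin (2 * pi * t))\<^sup>2 + (cos (2 * pi * t))\<^sup>2) + (cos (2 * pi * s))\<^sup>2)"
    by (simp add: simps power2_eq_square ring_distribs mult_ac)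
  then show "gmet ring_torus 0 0 (s, t) = (2 * pi)\<^sup>2"
    by simp
  have "gmet ring_torus 1 1 (s, t) = (2 * pi)\<^sup>2 * (4 + cos (2 * pi * s))\<^sup>2 *
      ((sin (2 * pi * t))\<^sup>2 + (cos (2 * pi * t))\<^sup>2)"
    by (simp add: simps power2_eq_square algebra_simps del: sin_cos_squared_add sin_cos_squared_add2 sin_cos_squared_add3)
  then show "gmet ring_torus 1 1 (s, t) = (2 * pi)\<^sup>2 * (4 + cos (2 * pi * s))\<^sup>2"
    by simp
qed

text \<open>The metric is diagonal and depends on \<open>s\<close> only, so with
  \<open>r = 4 + cos (2 * pi * s)\<close> the two fluxes reduce to \<open>r * pd 0 w\<close> and
  \<open>pd 1 w / r\<close>. The factor \<open>1 / (2 * pi)\<^sup>2\<close> reflects parameters of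
  period 1 instead of angles.\<close>

lemma LB_ring_torus:
  assumes "Ck 2 UNIV w"
  shows "LB ring_torus w (s, t) = 1 / (2 * pi)\<^sup>2 *
    (pd 0 (pd 0 w) (s, t) - 2 * pi * sin (2 * pi * s) / (4 + cos (2 * pi * s)) * pd 0 w (s, t)
      + pd 1 (pd 1 w) (s, t) / (4 + cos (2 * pi * s))\<^sup>2)"
proof -
  let ?r = "\<lambda>q::real \<times> real. 4 + cos (2 * pi * fst q)"
  have r: "?r q > 0" for q using four_plus_cos_pos .
  have g: "gdet ring_torus q = ((2 * pi)\<^sup>2 * ?r q)\<^sup>2" for q
    by (cases q) (simp add: gdet_def gmet_ring_torus[simplified] power2_eq_square)
  have sg: "sqrt (gdet ring_torus q) = (2 * pi)\<^sup>2 * ?r q" for q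
    unfolding g using r[of q] by (simp add: less_imp_le)
  have aux: "P * r * (P * r\<^sup>2 / (P * r)\<^sup>2 * x) = r * x" "P * r * (P / (P * r)\<^sup>2 * x) = x / r"
    if "P > 0" "r > 0" for P r x :: real
    using that by (simp_all add: field_simps power2_eq_square)
  have flux0: "sqrt (gdet ring_torus q) * (\<Sum>j\<in>{0,1}. ginv ring_torus 0 j q * pd j w q) = ?r q * pd 0 w q" for q
    using aux(1)[of "(2 * pi)\<^sup>2" "?r q"] r[of q] unfolding sg
    by (cases q) (simp add: ginv_def g gmet_ring_torus[simplified])
  have flux1: "sqrt (gdet ring_torus q) * (\<Sum>j\<in>{0,1}. ginv ring_torus 1 j q * pd j w q) = pd 1 w q / ?r q" for q
    using aux(2)[of "(2 * pi)\<^sup>2" "?r q"] r[of q] unfolding sg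
    by (cases q) (simp add: ginv_def g gmet_ring_torus[simplified])
  have dw: "(pd i w has_derivative frechet_derivative (pd i w) (at p)) (at p)" for i p
    using Ck_2_differentiable(2)[OF assms] by (simp add: frechet_derivative_works)
  have dr: "(?r has_derivative (\<lambda>h. - (2 * pi * sin (2 * pi * s) * fst h))) (at (s, t))"
    by (auto intro!: derivative_eq_intros)
  have 0: "pd 0 (\<lambda>q. ?r q * pd 0 w q) (s, t) =
      ?r (s, t) * pd 0 (pd 0 w) (s, t) - 2 * pi * sin (2 * pi * s) * pd 0 w (s, t)"
    unfolding pd_eq[OF has_derivative_mult[OF dr dw]] pd_eq[OF dw] by (simp add: coordvec_def)
  have 1: "pd 1 (\<lambda>q. pd 1 w q / ?r q) (s, t) = pd 1 (pd 1 w) (s, t) / ?r (s, t)"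
    using r[of "(s, t)"]
    by (subst pd_eq[OF has_derivative_divide'[OF dw dr]]) (auto simp: pd_eq[OF dw] coordvec_def)
  have aux': "1 / (P * r) * (r * x - y + z / r) = 1 / P * (x - y / r + z / r\<^sup>2)"
    if "P > 0" "r > 0" for P r x y z :: real
    using that by (simp add: field_simps power2_eq_square)
  have "LB ring_torus w (s, t) = 1 / sqrt (gdet ring_torus (s, t)) *
      (pd 0 (\<lambda>q. ?r q * pd 0 w q) (s, t) + pd 1 (\<lambda>q. pd 1 w q / ?r q) (s, t))"
    unfolding LB_def using flux0 flux1 by simp
  also have "\<dots> = 1 / ((2 * pi)\<^sup>2 * ?r (s, t)) * (?r (s, t) * pd 0 (pd 0 w) (s, t)
      - 2 * pi * sin (2 * pi * s) * pd 0 w (s, t) + pd 1 (pd 1 w) (s, t) / ?r (s, t))"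
    unfolding sg 0 1 ..
  also have "\<dots> = 1 / (2 * pi)\<^sup>2 *
    (pd 0 (pd 0 w) (s, t) - 2 * pi * sin (2 * pi * s) * pd 0 w (s, t) / ?r (s, t)
      + pd 1 (pd 1 w) (s, t) / (?r (s, t))\<^sup>2)"
    by (rule aux'[OF _ r]) simp
  finally show ?thesis by simp
qed

section \<open>Comparison\<close>

text \<open>The difference \<open>h - g\<close> has a minimum, with value 0, at \<open>a\<close>. A
  negative second derivative there would make it strictly decrease, hence negative, just to the
  right of \<open>a\<close>.\<close>

lemma DERIV2_touch:
  fixes g h :: "real \<Rightarrow> real"
  assumes "\<And>x. (g has_real_derivative g' x) (at x)" "\<And>x. (h has_real_derivative h' x) (at x)"
    and "(g' has_real_derivative g2) (at a)" "(h' has_real_derivative h2) (at a)"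
    and le: "\<And>x. g x \<le> h x" and eq: "g a = h a"
  shows "g' a = h' a" and "g2 \<le> h2"
proof -
  have d: "((\<lambda>x. h x - g x) has_real_derivative h' x - g' x) (at x)" for x
    using assms(1,2) by (intro derivative_intros)
  have d2: "((\<lambda>x. h' x - g' x) has_real_derivative h2 - g2) (at a)"
    using assms(3,4) by (intro derivative_intros)
  have "h' a - g' a = 0"
    using le eq by (intro DERIV_local_min[OF d, of 1]) auto
  then show g': "g' a = h' a" by simp
  show "g2 \<le> h2"
  proof (rule ccontr)
    assume "\<not> g2 \<le> h2"
    then obtain e where e: "e > 0" "\<And>y. \<lbrakk>0 < y; y < e\<rbrakk> \<Longrightarrow> h' (a + y) - g' (a + y) < 0"
      using DERIV_neg_dec_right[OF d2] g' by auto
    have "h (a + e/2) - g (a + e/2) < h a - g a"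
    proof (rule DERIV_neg_imp_decreasing_open[of a "a + e/2" "\<lambda>x. h x - g x"])
      show "\<exists>y. ((\<lambda>x. h x - g x) has_real_derivative y) (at x) \<and> y < 0" if "a < x" "x < a + e/2" for x
        using d[of x] e(2)[of "x - a"] that e(1) by auto
      show "continuous_on {a..a + e/2} (\<lambda>x. h x - g x)"
        using d by (meson DERIV_isCont continuous_at_imp_continuous_on)
    qed (use e(1) in auto)
    then show False using le[of "a + e/2"] eq by simp
  qed
qed

text \<open>At the contact point the first-order terms agree, the pure second derivatives are
  ordered and have nonnegative coefficients, and no mixed derivative occurs in the operator.\<close>

lemma LB_ring_torus_touch:
  assumes "Ck 2 UNIV w" "Ck 2 UNIV z" and le: "\<And>q. w q \<le> z q" and eq: "w p = z p"
  shows "LB ring_torus w p \<le> LB ring_torus z p"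
proof -
  obtain s t where p: "p = (s, t)" by fastforce
  note d' = pd_partial[OF Ck_2_differentiable(1)[OF assms(1)]] pd_partial[OF Ck_2_differentiable(1)[OF assms(2)]]
  note d2 = pd_partial[OF Ck_2_differentiable(2)[OF assms(1)]] pd_partial[OF Ck_2_differentiable(2)[OF assms(2)]]
  have 0: "pd 0 w (s, t) = pd 0 z (s, t)" "pd 0 (pd 0 w) (s, t) \<le> pd 0 (pd 0 z) (s, t)"
    using DERIV2_touch[OF d'(1) d'(3) d2(1) d2(3), of t t s] le eq p by auto
  have 1: "pd 1 (pd 1 w) (s, t) \<le> pd 1 (pd 1 z) (s, t)"
    using DERIV2_touch[OF d'(2) d'(4) d2(2) d2(4), of s s t] le eq p by auto
  show ?thesis
    unfolding p LB_ring_torus[OF assms(1)] LB_ring_torus[OF assms(2)] 0(1)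
    using 0(2) divide_right_mono[OF 1, of "(4 + cos (2 * pi * s))\<^sup>2"]
    by (intro mult_left_mono add_mono diff_right_mono) auto
qed

text \<open>At the earliest contact time \<open>v\<close> touches the barrier \<open>V\<close> from
  below, so \<open>touch\<close> makes it strictly decreasing in time at the contact point. It would
  then have exceeded the barrier slightly earlier.\<close>

lemma first_touching_comparison:
  fixes v :: "'a::t2_space \<Rightarrow> real \<Rightarrow> real" and V :: "'a \<Rightarrow> real"
  assumes "compact K"
    and cont: "continuous_on (K \<times> {0..<T}) (\<lambda>(x, t). v x t)" and contV: "continuous_on K V"
    and initial: "\<And>x. x \<in> K \<Longrightarrow> v x 0 < V x"
    and deriv: "\<And>x t. \<lbrakk>x \<in> K; 0 < t; t < T\<rbrakk> \<Longrightarrow> (v x has_real_derivative D x t) (at t)"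
    and touch: "\<And>x t. \<lbrakk>x \<in> K; 0 < t; t < T; v x t = V x; \<And>y. y \<in> K \<Longrightarrow> v y t \<le> V y\<rbrakk> \<Longrightarrow> D x t < 0"
    and "x \<in> K" "0 \<le> t" "t < T"
  shows "v x t < V x"
proof (rule ccontr)
  assume neg: "\<not> v x t < V x"
  \<comment> \<open>Cutting off at \<open>t < T\<close> makes the set of violations compact, so an
    earliest one exists although the time interval is half-open.\<close>
  define A where "A = {z \<in> K \<times> {0..t}. V (fst z) \<le> v (fst z) (snd z)}"
  have c: "compact (K \<times> {0..t})" using \<open>compact K\<close> by (intro compact_Times) auto
  have cv: "continuous_on (K \<times> {0..t}) (\<lambda>z. v (fst z) (snd z))"
    using cont \<open>t < T\<close> by (auto simp: case_prod_unfold intro: continuous_on_subset)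
  have cV: "continuous_on (K \<times> {0..t}) (\<lambda>z. V (fst z))"
    by (intro continuous_on_compose2[OF contV] continuous_intros) auto
  have "closed A"
    unfolding A_def by (rule continuous_on_closed_Collect_le[OF cV cv compact_imp_closed[OF c]])
  then have "compact ((K \<times> {0..t}) \<inter> A)"
    using c by (rule compact_Int_closed[rotated])
  moreover have "(K \<times> {0..t}) \<inter> A = A" by (auto simp: A_def)
  ultimately have "compact A" by simp
  moreover have "(x, t) \<in> A" using neg assms(7,8) by (auto simp: A_def)
  ultimately have "\<exists>z\<in>A. \<forall>y\<in>A. snd z \<le> snd y"
    by (intro continuous_attains_inf continuous_on_snd continuous_on_id) auto
  then obtain z where z: "z \<in> A" "\<And>y. y \<in> A \<Longrightarrow> snd z \<le> snd y"
    by blast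
  obtain y \<tau> where y: "z = (y, \<tau>)" by fastforce
  have y\<tau>: "y \<in> K" "0 \<le> \<tau>" "\<tau> \<le> t" "V y \<le> v y \<tau>" using z(1) y by (auto simp: A_def)
  have before: "v x' t' < V x'" if "x' \<in> K" "0 \<le> t'" "t' < \<tau>" for x' t'
    using z(2)[of "(x', t')"] that y y\<tau>(3) by (force simp: A_def)
  have "\<tau> > 0" using y\<tau> initial[of y] by (cases "\<tau> = 0") auto
  have "\<tau> < T" using y\<tau>(3) \<open>t < T\<close> by simp
  have le: "v x' \<tau> \<le> V x'" if "x' \<in> K" for x'
  proof (rule tendsto_upperbound)
    show "(v x' \<longlongrightarrow> v x' \<tau>) (at_left \<tau>)"
      using DERIV_isCont[OF deriv[OF that \<open>\<tau> > 0\<close> \<open>\<tau> < T\<close>]]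
      by (simp add: isCont_def filterlim_at_split)
    show "\<forall>\<^sub>F t' in at_left \<tau>. v x' t' \<le> V x'"
      unfolding eventually_at_left[OF \<open>\<tau> > 0\<close>]
      using before[OF that] \<open>\<tau> > 0\<close> by (auto intro!: exI[of _ 0] less_imp_le)
  qed simp
  have "D y \<tau> < 0"
    using touch[of y \<tau>] le y\<tau> \<open>\<tau> > 0\<close> \<open>\<tau> < T\<close> by (meson order_antisym)
  then obtain e where e: "e > 0" "\<And>h. \<lbrakk>0 < h; h < e\<rbrakk> \<Longrightarrow> v y \<tau> < v y (\<tau> - h)"
    using DERIV_neg_dec_left[OF deriv[OF y\<tau>(1) \<open>\<tau> > 0\<close> \<open>\<tau> < T\<close>]] by blast
  \<comment> \<open>The cap keeps \<open>\<tau> - h\<close> nonnegative; the value 0 is harmless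
    because \<open>before\<close> includes the initial time.\<close>
  define h where "h = min (e/2) \<tau>"
  have "0 < h" "h < e" "h \<le> \<tau>" using e(1) \<open>\<tau> > 0\<close> by (auto simp: h_def)
  then have "v y \<tau> < v y (\<tau> - h)" "v y (\<tau> - h) < V y"
    using e(2) before[of y "\<tau> - h"] y\<tau>(1) by auto
  with y\<tau>(4) show False by simp
qed

section \<open>Functions of the latitude\<close>

text \<open>The Laplace--Beltrami operator on functions of \<open>c = cos (2 * pi * s)\<close>, where \<open>h'\<close> and
  \<open>h''\<close> are the values of the first two \<open>c\<close>-derivatives at \<open>c\<close>.\<close>

definition zonal_LB :: "real \<Rightarrow> real \<Rightarrow> real \<Rightarrow> real" where
  "zonal_LB c h' h'' = (1 - c\<^sup>2) * h'' + (- c + (1 - c\<^sup>2) / (4 + c)) * h'"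

text \<open>The chain rule produces sines only in pairs, both in the second-order term and in the
  first-order one, so they become \<open>1 - c\<^sup>2\<close> and the parameter \<open>s\<close>
  disappears.\<close>

lemma LB_ring_torus_zonal:
  fixes H H' H'' :: "real \<Rightarrow> real"
  assumes H: "\<And>c. (H has_real_derivative H' c) (at c)" "\<And>c. (H' has_real_derivative H'' c) (at c)"
    and cont: "continuous_on UNIV H''"
  shows Ck_2_zonal: "Ck 2 UNIV (\<lambda>p::real \<times> real. H (cos (2 * pi * fst p)))"
    and pd_0_zonal: "pd 0 (\<lambda>p. H (cos (2 * pi * fst p))) (s, t)
      = - 2 * pi * sin (2 * pi * s) * H' (cos (2 * pi * s))"
    and pd_1_zonal: "pd 1 (\<lambda>p. H (cos (2 * pi * fst p))) (s, t) = 0"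
    and "c = cos (2 * pi * s) \<Longrightarrow> LB ring_torus (\<lambda>p. H (cos (2 * pi * fst p))) (s, t) = zonal_LB c (H' c) (H'' c)"
proof -
  let ?w = "\<lambda>p::real \<times> real. H (cos (2 * pi * fst p))"
  define W' where "W' s = - 2 * pi * sin (2 * pi * s) * H' (cos (2 * pi * s))" for s
  define W'' where "W'' s = (2 * pi)\<^sup>2 * ((sin (2 * pi * s))\<^sup>2 * H'' (cos (2 * pi * s))
    - cos (2 * pi * s) * H' (cos (2 * pi * s)))" for s
  have dc: "((\<lambda>s. cos (2 * pi * s)) has_real_derivative - 2 * pi * sin (2 * pi * s)) (at s)"
    and ds: "((\<lambda>s. - 2 * pi * sin (2 * pi * s)) has_real_derivative - (2 * pi)\<^sup>2 * cos (2 * pi * s)) (at s)" for s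
    by (auto intro!: derivative_eq_intros simp: power2_eq_square)
  have W: "((\<lambda>s. H (cos (2 * pi * s))) has_real_derivative W' s) (at s)" for s
    by (rule DERIV_cong[OF DERIV_chain2[OF H(1) dc]]) (simp add: W'_def)
  have W': "(W' has_real_derivative W'' s) (at s)" for s
    unfolding W'_def[abs_def] W''_def
    by (rule DERIV_cong[OF DERIV_mult[OF ds DERIV_chain2[OF H(2) dc]]])
      (simp add: power2_eq_square algebra_simps)
  have contH': "continuous_on UNIV H'"
    using H(2) by (meson DERIV_isCont continuous_at_imp_continuous_on)
  have contW'': "continuous_on UNIV W''"
    unfolding W''_def[abs_def]
    by (intro continuous_intros continuous_on_compose2[OF cont] continuous_on_compose2[OF contH']) auto
  show Ck: "Ck 2 UNIV ?w"
    by (rule Ck_2_fst[OF W W' contW''])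
  have D: "pd i (\<lambda>p. G (fst p)) (s, t) = (if i = 0 then G' else 0)"
    if "(G has_real_derivative G') (at s)" for G G' i and s t :: real
  proof -
    have "((\<lambda>p::real \<times> real. G (fst p)) has_derivative (\<lambda>v. G' * fst v)) (at (s, t))"
      using has_derivative_compose[OF has_derivative_fst[OF has_derivative_ident], of G "(*) G'" "(s, t)" UNIV]
        that[unfolded has_field_derivative_def] by simp
    from pd_eq[OF this] show ?thesis by (simp add: coordvec_def)
  qed
  show p0: "pd 0 ?w (s, t) = - 2 * pi * sin (2 * pi * s) * H' (cos (2 * pi * s))" for s t
    using D[OF W, of 0] by (simp add: W'_def)
  show p1: "pd 1 ?w (s, t) = 0" for s t
    using D[OF W, of 1] by simp
  have "pd 0 ?w = (\<lambda>p. W' (fst p))" "pd 1 ?w = (\<lambda>p. 0)"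
    using p0 p1 by (auto simp: W'_def)
  then have "pd 0 (pd 0 ?w) (s, t) = W'' s" "pd 1 (pd 1 ?w) (s, t) = 0"
    using D[OF W', of 0] D[OF DERIV_const, of 1] by auto
  then have LB: "LB ring_torus ?w (s, t) = 1 / (2 * pi)\<^sup>2 *
    (W'' s - 2 * pi * sin (2 * pi * s) / (4 + cos (2 * pi * s)) * (- 2 * pi * sin (2 * pi * s) * H' (cos (2 * pi * s))))"
    unfolding LB_ring_torus[OF Ck] p0 by simp
  have aux: "1 / (2 * pi)\<^sup>2 * ((2 * pi)\<^sup>2 * (S\<^sup>2 * x - c * y) - 2 * pi * S / r * (- 2 * pi * S * y))
      = S\<^sup>2 * x + (- c + S\<^sup>2 / r) * y" if "r > 0" for S c r x y :: real
    using that by (simp add: field_simps power2_eq_square)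
  show "LB ring_torus ?w (s, t) = zonal_LB c (H' c) (H'' c)" if c: "c = cos (2 * pi * s)"
    unfolding LB W''_def zonal_LB_def aux[OF four_plus_cos_pos] c by (simp only: sin_squared_eq)
qed

text \<open>Distance to the axis minus the radius of the core circle: an extension of
  \<open>cos (2 * pi * s)\<close> from the torus to all of space, where patterns are
  represented.\<close>

definition zonal_coord :: "real^3 \<Rightarrow> real" where
  "zonal_coord x = sqrt ((x $ 1)\<^sup>2 + (x $ 2)\<^sup>2) - 4"

lemma zonal_coord_ring_torus: "zonal_coord (ring_torus p) = cos (2 * pi * fst p)"
proof -
  obtain s t where p: "p = (s, t)" by fastforce
  have "(ring_torus p $ 1)\<^sup>2 + (ring_torus p $ 2)\<^sup>2 = (4 + cos (2 * pi * s))\<^sup>2"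
    unfolding p ring_torus_components by (simp add: power_mult_distrib flip: distrib_left)
  then show ?thesis
    using four_plus_cos_pos[of "2 * pi * s"] by (simp add: zonal_coord_def p)
qed

lemma zonal_coord_range: "x \<in> range ring_torus \<Longrightarrow> zonal_coord x \<in> {-1..1}"
  using zonal_coord_ring_torus by auto

lemma continuous_on_zonal_coord: "continuous_on S zonal_coord"
  unfolding zonal_coord_def[abs_def] by (intro continuous_intros)

lemma ring_torus_frac: "ring_torus (frac s, frac t) = ring_torus (s, t)"
proof -
  have *: "cos (2 * pi * frac x) = cos (2 * pi * x)" "sin (2 * pi * frac x) = sin (2 * pi * x)" for x
    by (simp_all add: frac_def right_diff_distrib cos_diff sin_diff)
  show ?thesis by (simp add: ring_torus_def *)
qed

lemma continuous_on_ring_torus: "continuous_on S ring_torus"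
  unfolding ring_torus_def[abs_def] by (intro continuous_intros)

lemma compact_range_ring_torus: "compact (range ring_torus)"
proof -
  have "range ring_torus = ring_torus ` ({0..1} \<times> {0..1})"
  proof
    show "range ring_torus \<subseteq> ring_torus ` ({0..1} \<times> {0..1})"
    proof clarify
      fix s t :: real
      have "(frac s, frac t) \<in> {0..1} \<times> {0..1}"
        by (simp add: frac_lt_1 less_imp_le)
      then show "ring_torus (s, t) \<in> ring_torus ` ({0..1} \<times> {0..1})"
        using ring_torus_frac by (metis imageI)
    qed
  qed auto
  then show ?thesis
    by (simp only:) (intro compact_continuous_image continuous_on_ring_torus compact_Times compact_Icc)
qed

section \<open>Barriers and stability\<close>

text \<open>A positive strict supersolution \<open>\<phi>\<close> of the linearized equation certifies that its first
  eigenvalue is positive, and bends the stationary solution into strict barriers on both sides.\<close>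

lemma zonal_barriers:
  fixes U U' U'' \<phi> \<phi>' \<phi>'' f g :: "real \<Rightarrow> real"
  assumes contU: "continuous_on {-1..1} U" and cont\<phi>: "continuous_on {-1..1} \<phi>" "continuous_on {-1..1} \<phi>'" "continuous_on {-1..1} \<phi>''"
    and f: "\<And>u. (f has_real_derivative g u) (at u)" and g: "continuous_on UNIV g"
    and pos: "\<And>c. c \<in> {-1..1} \<Longrightarrow> \<phi> c > 0"
    and stat: "\<And>c. c \<in> {-1..1} \<Longrightarrow> zonal_LB c (U' c) (U'' c) + f (U c) = 0"
    and lin: "\<And>c. c \<in> {-1..1} \<Longrightarrow> zonal_LB c (\<phi>' c) (\<phi>'' c) + g (U c) * \<phi> c < 0"
    and "\<epsilon> > 0"
  obtains h where "h > 0" and "\<And>c. c \<in> {-1..1} \<Longrightarrow> h * \<phi> c < \<epsilon>"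
    and "\<And>c. c \<in> {-1..1} \<Longrightarrow> zonal_LB c (U' c + h * \<phi>' c) (U'' c + h * \<phi>'' c) + f (U c + h * \<phi> c) < 0"
    and "\<And>c. c \<in> {-1..1} \<Longrightarrow> zonal_LB c (U' c + - h * \<phi>' c) (U'' c + - h * \<phi>'' c) + f (U c + - h * \<phi> c) > 0"
proof -
  \<comment> \<open>The linearized operator applied to \<open>\<phi>\<close>, with \<open>g\<close>
    evaluated at a point displaced by \<open>snd z\<close> from \<open>U\<close>. Uniform continuity
    keeps it negative for small displacements.\<close>
  define M where "M z = zonal_LB (fst z) (\<phi>' (fst z)) (\<phi>'' (fst z)) + g (U (fst z) + snd z) * \<phi> (fst z)" for z
  have "continuous_on ({-1..1} \<times> {-1..1}) M"
    unfolding M_def[abs_def] zonal_LB_def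
    by (intro continuous_intros continuous_on_compose2[OF g] continuous_on_compose2[OF contU]
        continuous_on_compose2[OF cont\<phi>(1)] continuous_on_compose2[OF cont\<phi>(2)] continuous_on_compose2[OF cont\<phi>(3)]) auto
  then have uc: "uniformly_continuous_on ({-1..1} \<times> {-1..1}) M"
    by (intro compact_uniformly_continuous compact_Times) auto
  have "continuous_on {-1..1} (\<lambda>c. M (c, 0))"
    by (intro continuous_on_compose2[OF \<open>continuous_on _ M\<close>] continuous_intros) auto
  then obtain c0 where c0: "c0 \<in> {-1..1}" "\<And>c. c \<in> {-1..1} \<Longrightarrow> M (c, 0) \<le> M (c0, 0)"
    using continuous_attains_sup[of "{-1..1::real}" "\<lambda>c. M (c, 0)"] by auto
  have "M (c0, 0) < 0"
    using lin[OF c0(1)] by (simp add: M_def)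
  then obtain d where d: "d > 0"
    "\<And>z z'. \<lbrakk>z \<in> {-1..1} \<times> {-1..1}; z' \<in> {-1..1} \<times> {-1..1}; dist z' z < d\<rbrakk> \<Longrightarrow> dist (M z') (M z) < - M (c0, 0)"
    using uc unfolding uniformly_continuous_on_def by (metis neg_0_less_iff_less)
  have neg: "M (c, y) < 0" if "c \<in> {-1..1}" "\<bar>y\<bar> < d" "\<bar>y\<bar> \<le> 1" for c y
  proof -
    have "- 1 \<le> y" "y \<le> 1" using that(3) by auto
    then show ?thesis
      using d(2)[of "(c, 0)" "(c, y)"] that c0(2)[of c] by (auto simp: dist_Pair_Pair dist_real_def)
  qed
  obtain c1 where c1: "c1 \<in> {-1..1}" "\<And>c. c \<in> {-1..1} \<Longrightarrow> \<phi> c \<le> \<phi> c1"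
    using continuous_attains_sup[OF _ _ cont\<phi>(1)] by auto
  define m where "m = min \<epsilon> (min d 1)"
  \<comment> \<open>Normalized so that the maximum of \<open>h * \<phi>\<close> is
    \<open>m / 2\<close>, below all the bounds collected in \<open>m\<close>.\<close>
  define h where "h = m / (2 * \<phi> c1)"
  have "m > 0" using d(1) \<open>\<epsilon> > 0\<close> by (simp add: m_def)
  then have "h > 0" using pos[OF c1(1)] by (simp add: h_def)
  have small: "h * \<phi> c < m" if "c \<in> {-1..1}" for c
  proof -
    have "h * \<phi> c \<le> h * \<phi> c1" using c1(2)[OF that] \<open>h > 0\<close> by simp
    also have "\<dots> = m / 2" using pos[OF c1(1)] by (simp add: h_def)
    finally show ?thesis using \<open>m > 0\<close> by simp
  qed
  have lin_LB: "zonal_LB c (x + k * x') (y + k * y') = zonal_LB c x y + k * zonal_LB c x' y'" for c x x' y y' k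
    by (simp add: zonal_LB_def algebra_simps add_divide_distrib diff_divide_distrib)
  have neg': "zonal_LB c (\<phi>' c) (\<phi>'' c) + g \<xi> * \<phi> c < 0" if "c \<in> {-1..1}" "\<bar>\<xi> - U c\<bar> \<le> h * \<phi> c" for c \<xi>
    using neg[OF that(1), of "\<xi> - U c"] that(2) small[OF that(1)] by (auto simp: M_def m_def)
  show ?thesis
  proof (rule that[OF \<open>h > 0\<close>])
    fix c :: real assume c: "c \<in> {-1..1}"
    have h\<phi>: "h * \<phi> c > 0" using \<open>h > 0\<close> pos[OF c] by simp
    show "h * \<phi> c < \<epsilon>" using small[OF c] by (simp add: m_def)
    \<comment> \<open>By the mean value theorem and stationarity, the defect of the barrier is
      exactly \<open>h\<close> times the operator in \<open>neg'\<close> at the intermediate point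
      \<open>\<xi>\<close>.\<close>
    obtain \<xi> where \<xi>: "U c < \<xi>" "\<xi> < U c + h * \<phi> c" "f (U c + h * \<phi> c) - f (U c) = h * \<phi> c * g \<xi>"
      using MVT2[of "U c" "U c + h * \<phi> c" f g] h\<phi> f by auto
    have "h * (zonal_LB c (\<phi>' c) (\<phi>'' c) + g \<xi> * \<phi> c) < 0"
      using neg'[OF c, of \<xi>] \<xi>(1,2) \<open>h > 0\<close> by (simp add: mult_pos_neg)
    then show "zonal_LB c (U' c + h * \<phi>' c) (U'' c + h * \<phi>'' c) + f (U c + h * \<phi> c) < 0"
      using \<xi>(3) stat[OF c] unfolding lin_LB by (simp add: algebra_simps)
    obtain \<xi> where \<xi>: "U c - h * \<phi> c < \<xi>" "\<xi> < U c" "f (U c) - f (U c - h * \<phi> c) = h * \<phi> c * g \<xi>"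
      using MVT2[of "U c - h * \<phi> c" "U c" f g] h\<phi> f by auto
    have "h * (zonal_LB c (\<phi>' c) (\<phi>'' c) + g \<xi> * \<phi> c) < 0"
      using neg'[OF c, of \<xi>] \<xi>(1,2) \<open>h > 0\<close> by (simp add: mult_pos_neg)
    then show "zonal_LB c (U' c + - h * \<phi>' c) (U'' c + - h * \<phi>'' c) + f (U c + - h * \<phi> c) > 0"
      using \<xi>(3) stat[OF c] unfolding lin_LB by (simp add: algebra_simps)
  qed
qed

text \<open>Data within \<open>h\<close> times the minimum of \<open>\<phi>\<close> start strictly
  between the barriers \<open>U - h * \<phi>\<close> and \<open>U + h * \<phi>\<close>. Comparison
  keeps the solution there, hence within \<open>\<epsilon>\<close> of \<open>U\<close>.\<close>

lemma stable_zonal: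
  fixes U U' U'' \<phi> \<phi>' \<phi>'' f g :: "real \<Rightarrow> real"
  assumes U: "\<And>c. (U has_real_derivative U' c) (at c)" "\<And>c. (U' has_real_derivative U'' c) (at c)"
      "continuous_on UNIV U''"
    and \<phi>: "\<And>c. (\<phi> has_real_derivative \<phi>' c) (at c)" "\<And>c. (\<phi>' has_real_derivative \<phi>'' c) (at c)"
      "continuous_on UNIV \<phi>''"
    and f: "\<And>u. (f has_real_derivative g u) (at u)" "continuous_on UNIV g"
    and pos: "\<And>c. c \<in> {-1..1} \<Longrightarrow> \<phi> c > 0"
    and stat: "\<And>c. c \<in> {-1..1} \<Longrightarrow> zonal_LB c (U' c) (U'' c) + f (U c) = 0"
    and lin: "\<And>c. c \<in> {-1..1} \<Longrightarrow> zonal_LB c (\<phi>' c) (\<phi>'' c) + g (U c) * \<phi> c < 0"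
  shows "stable f ring_torus (\<lambda>x. U (zonal_coord x))"
  unfolding stable_def
proof (intro allI impI)
  fix \<epsilon> :: real assume "\<epsilon> > 0"
  have contU: "continuous_on S U" and cont\<phi>: "continuous_on S \<phi>" "continuous_on S \<phi>'" for S
    using U(1) \<phi>(1,2) by (meson DERIV_isCont continuous_at_imp_continuous_on)+
  obtain h where h: "h > 0" "\<And>c. c \<in> {-1..1} \<Longrightarrow> h * \<phi> c < \<epsilon>"
    "\<And>c. c \<in> {-1..1} \<Longrightarrow> zonal_LB c (U' c + h * \<phi>' c) (U'' c + h * \<phi>'' c) + f (U c + h * \<phi> c) < 0"
    "\<And>c. c \<in> {-1..1} \<Longrightarrow> zonal_LB c (U' c + - h * \<phi>' c) (U'' c + - h * \<phi>'' c) + f (U c + - h * \<phi> c) > 0"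
    using zonal_barriers[OF contU cont\<phi> continuous_on_subset[OF \<phi>(3)] f pos stat lin \<open>\<epsilon> > 0\<close>] by auto
  obtain c0 where c0: "c0 \<in> {-1..1}" "\<And>c. c \<in> {-1..1} \<Longrightarrow> \<phi> c0 \<le> \<phi> c"
    using continuous_attains_inf[OF _ _ cont\<phi>(1), of "{-1..1}"] by auto
  have barrier: "Ck 2 UNIV (\<lambda>p::real \<times> real. U (cos (2 * pi * fst p)) + k * \<phi> (cos (2 * pi * fst p)))"
    "c = cos (2 * pi * fst p) \<Longrightarrow> LB ring_torus (\<lambda>p. U (cos (2 * pi * fst p)) + k * \<phi> (cos (2 * pi * fst p))) p
       = zonal_LB c (U' c + k * \<phi>' c) (U'' c + k * \<phi>'' c)" for k p c
  proof -
    have d: "((\<lambda>c. U c + k * \<phi> c) has_real_derivative U' c + k * \<phi>' c) (at c)"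
      "((\<lambda>c. U' c + k * \<phi>' c) has_real_derivative U'' c + k * \<phi>'' c) (at c)" for c
      using U(1,2) \<phi>(1,2) by (auto intro!: derivative_eq_intros)
    have "continuous_on UNIV (\<lambda>c. U'' c + k * \<phi>'' c)"
      using U(3) \<phi>(3) by (intro continuous_intros)
    note zonal = LB_ring_torus_zonal[OF d this]
    show "Ck 2 UNIV (\<lambda>p::real \<times> real. U (cos (2 * pi * fst p)) + k * \<phi> (cos (2 * pi * fst p)))"
      using zonal(1) .
    show "c = cos (2 * pi * fst p) \<Longrightarrow> LB ring_torus (\<lambda>p. U (cos (2 * pi * fst p)) + k * \<phi> (cos (2 * pi * fst p))) p
       = zonal_LB c (U' c + k * \<phi>' c) (U'' c + k * \<phi>'' c)"
      using zonal(4)[of c "fst p" "snd p"] by simp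
  qed
  let ?\<rho> = zonal_coord
  have contV: "continuous_on S (\<lambda>x. U (?\<rho> x) + k * \<phi> (?\<rho> x))" for k S
    by (intro continuous_intros continuous_on_compose2[OF contU[of UNIV]] continuous_on_compose2[OF cont\<phi>(1)[of UNIV]]
        continuous_on_zonal_coord) auto
  show "\<exists>\<delta>>0. \<forall>T u. T > 0 \<longrightarrow> rd_solution f ring_torus T u \<longrightarrow>
        (\<forall>x\<in>range ring_torus. \<bar>u x 0 - U (?\<rho> x)\<bar> < \<delta>) \<longrightarrow>
        (\<forall>t\<in>{0<..<T}. \<forall>x\<in>range ring_torus. \<bar>u x t - U (?\<rho> x)\<bar> < \<epsilon>)"
  proof (intro exI[of _ "h * \<phi> c0"] conjI allI impI ballI)
    show "0 < h * \<phi> c0" using h(1) pos[OF c0(1)] by simp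
    fix T u t x
    assume sol: "rd_solution f ring_torus T u"
      and init: "\<forall>x\<in>range ring_torus. \<bar>u x 0 - U (?\<rho> x)\<bar> < h * \<phi> c0"
      and t: "t \<in> {0<..<T}" and x: "x \<in> range ring_torus"
    \<comment> \<open>One parameter is chosen for each surface point, so that the right-hand side of
      the equation becomes a function on the surface.\<close>
    define P where "P = inv ring_torus"
    define D where "D x t = LB ring_torus (\<lambda>q. u (ring_torus q) t) (P x) + f (u x t)" for x t
    have P: "ring_torus (P x) = x" if "x \<in> range ring_torus" for x
      using that unfolding P_def by (rule f_inv_into_f)
    have \<rho>P: "?\<rho> x = cos (2 * pi * fst (P x))" if "x \<in> range ring_torus" for x
      using zonal_coord_ring_torus[of "P x"] P[OF that] by simp
    have contu: "continuous_on (range ring_torus \<times> {0..<T}) (\<lambda>(x, t). u x t)"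
      and C2: "\<And>t. \<lbrakk>0 < t; t < T\<rbrakk> \<Longrightarrow> Ck 2 UNIV (\<lambda>q. u (ring_torus q) t)"
      using sol unfolding rd_solution_def by auto
    have D: "(u x has_real_derivative D x t) (at t)" if "x \<in> range ring_torus" "0 < t" "t < T" for x t
    proof -
      from sol[unfolded rd_solution_def, THEN conjunct2, THEN conjunct2, rule_format, of t "P x"] that(2,3)
      have "((\<lambda>s. u (ring_torus (P x)) s) has_real_derivative
          LB ring_torus (\<lambda>q. u (ring_torus q) t) (P x) + f (u (ring_torus (P x)) t)) (at t)"
        by simp
      then show ?thesis unfolding P[OF that(1)] D_def .
    qed
    have init': "\<bar>u x 0 - U (?\<rho> x)\<bar> < h * \<phi> (?\<rho> x)" if "x \<in> range ring_torus" for x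
      using init that c0(2)[OF zonal_coord_range[OF that]] h(1) by (meson less_le_trans mult_left_mono less_imp_le)
    have upper: "u x t < U (?\<rho> x) + h * \<phi> (?\<rho> x)"
    proof (rule first_touching_comparison[OF compact_range_ring_torus contu contV _ D])
      show "D x t < 0" if x: "x \<in> range ring_torus" and t: "0 < t" "t < T"
        and eq: "u x t = U (?\<rho> x) + h * \<phi> (?\<rho> x)"
        and le: "\<And>y. y \<in> range ring_torus \<Longrightarrow> u y t \<le> U (?\<rho> y) + h * \<phi> (?\<rho> y)" for x t
      proof -
        have "LB ring_torus (\<lambda>q. u (ring_torus q) t) (P x)
            \<le> LB ring_torus (\<lambda>p. U (cos (2 * pi * fst p)) + h * \<phi> (cos (2 * pi * fst p))) (P x)"
          using eq le[OF rangeI] P[OF x] \<rho>P[OF x]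
          by (intro LB_ring_torus_touch[OF C2[OF t] barrier(1)]) (auto simp: zonal_coord_ring_torus)
        then show ?thesis
          unfolding D_def barrier(2)[OF \<rho>P[OF x]] using h(3)[OF zonal_coord_range[OF x]] eq by simp
      qed
      show "u y 0 < U (?\<rho> y) + h * \<phi> (?\<rho> y)" if "y \<in> range ring_torus" for y
        using init'[OF that] by linarith
    qed (use x t in auto)
    \<comment> \<open>The lower bound is the same comparison with all signs reversed.\<close>
    have lower: "- u x t < - (U (?\<rho> x) + - h * \<phi> (?\<rho> x))"
    proof (rule first_touching_comparison[OF compact_range_ring_torus _ continuous_on_minus[OF contV] _ DERIV_minus[OF D]])
      show "- D x t < 0" if x: "x \<in> range ring_torus" and t: "0 < t" "t < T"
        and eq: "- u x t = - (U (?\<rho> x) + - h * \<phi> (?\<rho> x))"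
        and le: "\<And>y. y \<in> range ring_torus \<Longrightarrow> - u y t \<le> - (U (?\<rho> y) + - h * \<phi> (?\<rho> y))" for x t
      proof -
        have "LB ring_torus (\<lambda>p. U (cos (2 * pi * fst p)) + - h * \<phi> (cos (2 * pi * fst p))) (P x)
            \<le> LB ring_torus (\<lambda>q. u (ring_torus q) t) (P x)"
          using eq le[OF rangeI, unfolded neg_le_iff_le] P[OF x] \<rho>P[OF x]
          by (intro LB_ring_torus_touch[OF barrier(1) C2[OF t]]) (auto simp: zonal_coord_ring_torus)
        then show ?thesis
          unfolding D_def barrier(2)[OF \<rho>P[OF x]] using h(4)[OF zonal_coord_range[OF x]] eq[unfolded neg_equal_iff_equal] by simp
      qed
      show "- u y 0 < - (U (?\<rho> y) + - h * \<phi> (?\<rho> y))" if "y \<in> range ring_torus" for y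
        using init'[OF that] by linarith
      show "continuous_on (range ring_torus \<times> {0..<T}) (\<lambda>(x, t). - u x t)"
        using continuous_on_minus[OF contu] by (simp add: case_prod_unfold)
    qed (use x t in auto)
    show "\<bar>u x t - U (?\<rho> x)\<bar> < \<epsilon>"
      using upper lower h(2)[OF zonal_coord_range[OF x]] by simp
  qed
qed

section \<open>The nonlinearity and the front\<close>

lemma antiderivative_exists:
  fixes g :: "real \<Rightarrow> real"
  assumes "continuous_on UNIV g"
  obtains G where "\<And>x. (G has_real_derivative g x) (at x)"
proof -
  have "\<exists>G. \<forall>x::real. - \<infinity> < ereal x \<longrightarrow> ereal x < \<infinity> \<longrightarrow> (G has_vector_derivative g x) (at x)"
    using assms by (intro einterval_antiderivative) (auto simp: continuous_on_eq_continuous_at)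
  then show ?thesis
    using that by (auto simp: has_real_derivative_iff_has_vector_derivative)
qed

text \<open>The chain rule forces the derivative of \<open>f\<close> to be \<open>q\<close> composed
  with the inverse of \<open>U\<close>. This is continuous on the compact image of \<open>U\<close>;
  Tietze extends it to the line, and an antiderivative with the right constant gives
  \<open>f\<close>.\<close>

lemma C1_factor_through_increasing:
  fixes U U' F q :: "real \<Rightarrow> real"
  assumes U: "\<And>c. c \<in> {a..b} \<Longrightarrow> (U has_real_derivative U' c) (at c)" "\<And>c. c \<in> {a..b} \<Longrightarrow> U' c > 0"
    and F: "\<And>c. c \<in> {a..b} \<Longrightarrow> (F has_real_derivative q c * U' c) (at c)"
    and q: "continuous_on {a..b} q"
  obtains f g where "\<And>u. (f has_real_derivative g u) (at u)" "continuous_on UNIV g"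
    "\<And>c. c \<in> {a..b} \<Longrightarrow> f (U c) = F c" "\<And>c. c \<in> {a..b} \<Longrightarrow> g (U c) = q c"
proof -
  have contU: "continuous_on {a..b} U"
    using U(1) by (meson DERIV_isCont continuous_at_imp_continuous_on)
  have less: "U x < U y" if "x \<in> {a..b}" "y \<in> {a..b}" "x < y" for x y
  proof (rule DERIV_pos_imp_increasing[OF that(3)])
    fix z assume "x \<le> z" "z \<le> y"
    then show "\<exists>d. (U has_real_derivative d) (at z) \<and> d > 0"
      using U[of z] that(1,2) by auto
  qed
  have inj: "inj_on U {a..b}"
    by (rule inj_onI) (metis less less_irrefl linorder_neqE_linordered_idom)
  define W where "W = inv_into {a..b} U"
  have W: "W (U c) = c" if "c \<in> {a..b}" for c
    unfolding W_def using inj that by (rule inv_into_f_f)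
  have "continuous_on (U ` {a..b}) W"
    using contU W by (intro continuous_on_inv) auto
  then have "continuous_on (U ` {a..b}) (\<lambda>u. q (W u))"
    by (rule continuous_on_compose2[OF q]) (auto simp: W)
  moreover have "closedin (top_of_set UNIV) (U ` {a..b})"
    using compact_continuous_image[OF contU] by (simp add: compact_imp_closed)
  ultimately obtain g where g: "continuous_on UNIV g" "\<And>u. u \<in> U ` {a..b} \<Longrightarrow> g u = q (W u)"
    by (rule Tietze_unbounded) blast
  have gU: "g (U c) = q c" if "c \<in> {a..b}" for c
    using g(2)[of "U c"] W that by auto
  obtain G where G: "\<And>u. (G has_real_derivative g u) (at u)"
    using antiderivative_exists[OF g(1)] by blast
  have "((\<lambda>c. F c - G (U c)) has_real_derivative 0) (at c within {a..b})" if "c \<in> {a..b}" for c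
  proof -
    have "((\<lambda>c. F c - G (U c)) has_real_derivative q c * U' c - g (U c) * U' c) (at c)"
      using that by (intro derivative_intros F DERIV_chain2[OF G] U(1))
    then show ?thesis
      using gU[OF that] by (simp add: has_field_derivative_at_within)
  qed
  then obtain k where k: "\<And>c. c \<in> {a..b} \<Longrightarrow> F c - G (U c) = k"
    using has_field_derivative_zero_constant[of "{a..b}" "\<lambda>c. F c - G (U c)"] by auto
  show ?thesis
  proof (rule that)
    show "((\<lambda>u. G u + k) has_real_derivative g u) (at u)" for u
      using DERIV_add[OF G DERIV_const] by simp
    show "G (U c) + k = F c" if "c \<in> {a..b}" for c
      using k[OF that] by simp
  qed (use g gU in auto)
qed

section \<open>The polynomial inequality for the linearized operator\<close>

text \<open>The five expansions are the Bernstein forms, on the given subintervals, of the polynomial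
  minus 100; all their coefficients are positive.\<close>

lemma profile_polynomial_pos:
  fixes c :: real
  assumes "-1 \<le> c" "c \<le> 1"
  shows "7744 * c^8 - 1345168 * c^7 - 11782743 * c^6 - 26434146 * c^5
    + 1046880 * c^4 + 30671466 * c^3 + 22975023 * c^2 + 6620448 * c + 684496 > 0" (is "?P > 0")
proof -
  have "?P > 0" if "-1 \<le> c" "c \<le> -1/2"
  proof -
    \<comment> \<open>Here and in the other cases \<open>y + z = 1\<close> and both are nonnegative
      on the subinterval; the factor in front makes the coefficients integers.\<close>
    define y z where "y = 2*c + 2" and "z = -1 - 2*c"
    have "64 * (?P - 100) =
        218796800 * z^8
        + 1031810560 * y * z^7
        + 1949284800 * y^2 * z^6
        + 1882570256 * y^3 * z^5
        + 987570580 * y^4 * z^4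
        + 280687200 * y^5 * z^3
        + 42630305 * y^6 * z^2
        + 3335770 * y^7 * z
        + 123237 * y^8"
      unfolding y_def z_def by algebra
    also have "\<dots> \<ge> 0"
    proof -
      have "y \<ge> 0" "z \<ge> 0" using that by (auto simp: y_def z_def)
      then show ?thesis by simp
    qed
    finally show ?thesis by simp
  qed
  moreover
  have "?P > 0" if "-1/2 \<le> c" "c \<le> -3/8"
  proof -
    define y z where "y = 8*c + 4" and "z = -3 - 8*c"
    have "262144 * (?P - 100) =
        504778752 * z^8
        + 1631959040 * y * z^7
        + 3108929280 * y^2 * z^6
        + 7014508800 * y^3 * z^5
        + 12070079280 * y^4 * z^4
        + 11477240376 * y^5 * z^3
        + 5652708585 * y^6 * z^2
        + 1349389560 * y^7 * z
        + 136602000 * y^8"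
      unfolding y_def z_def by algebra
    also have "\<dots> \<ge> 0"
    proof -
      have "y \<ge> 0" "z \<ge> 0" using that by (auto simp: y_def z_def)
      then show ?thesis by simp
    qed
    finally show ?thesis by simp
  qed
  moreover
  have "?P > 0" if "-3/8 \<le> c" "c \<le> -1/4"
  proof -
    define y z where "y = 8*c + 3" and "z = -2 - 8*c"
    have "262144 * (?P - 100) =
        136602000 * z^8
        + 836242440 * y * z^7
        + 2060678745 * y^2 * z^6
        + 4204235604 * y^3 * z^5
        + 11625353820 * y^4 * z^4
        + 24022514400 * y^5 * z^3
        + 27175609200 * y^6 * z^2
        + 15366932800 * y^7 * z
        + 3431681600 * y^8"
      unfolding y_def z_def by algebra
    also have "\<dots> \<ge> 0"
    proof -
      have "y \<ge> 0" "z \<ge> 0" using that by (auto simp: y_def z_def)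
      then show ?thesis by simp
    qed
    finally show ?thesis by simp
  qed
  moreover
  have "?P > 0" if "-1/4 \<le> c" "c \<le> 0"
  proof -
    define y z where "y = 4*c + 1" and "z = - (4*c)"
    have "4096 * (?P - 100) =
        53620025 * z^8
        + 806663950 * y * z^7
        + 5126172225 * y^2 * z^6
        + 17882277000 * y^3 * z^5
        + 37379134080 * y^4 * z^4
        + 47944564608 * y^5 * z^3
        + 36918243072 * y^6 * z^2
        + 15646949376 * y^7 * z
        + 2803286016 * y^8"
      unfolding y_def z_def by algebra
    also have "\<dots> \<ge> 0"
    proof -
      have "y \<ge> 0" "z \<ge> 0" using that by (auto simp: y_def z_def)
      then show ?thesis by simp
    qed
    finally show ?thesis by simp
  qed
  moreover
  have "?P > 0" if "0 \<le> c" "c \<le> 1"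
  proof -
    define y z where "y = c" and "z = 1 - c"
    have "?P - 100 =
        684396 * z^8
        + 12095616 * y * z^7
        + 88481247 * y^2 * z^6
        + 345877188 * y^3 * z^5
        + 778652955 * y^4 * z^4
        + 1014010350 * y^5 * z^3
        + 724728600 * y^6 * z^2
        + 243000200 * y^7 * z
        + 22443900 * y^8"
      unfolding y_def z_def by algebra
    also have "\<dots> \<ge> 0"
    proof -
      have "y \<ge> 0" "z \<ge> 0" using that by (auto simp: y_def z_def)
      then show ?thesis by simp
    qed
    finally show ?thesis by simp
  qed
  ultimately show ?thesis using assms by linarith
qed

text \<open>Writing \<open>v\<close> and \<open>v + e\<close> for the logarithmic derivatives of \<open>U'\<close> and of the supersolution
  \<open>\<phi>\<close>, the left-hand side below is the linearized operator applied to \<open>\<phi>\<close>, divided by \<open>\<phi>\<close>. Only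
  the zero of \<open>a * e + c\<close> near \<open>-2/5\<close> constrains the choice, since elsewhere a steep \<open>v\<close> vanishing
  near that point dominates; the quadratic \<open>e\<close> is tuned so that this is the only zero and the
  inequality holds there.\<close>

lemma profile_linearization_neg:
  fixes c :: real
  assumes "c \<in> {-1..1}"
  defines "a \<equiv> 1 - c\<^sup>2" and "b \<equiv> - c + (1 - c\<^sup>2) / (4 + c)"
    and "b' \<equiv> - 1 - 2 * c / (4 + c) - (1 - c\<^sup>2) / (4 + c)\<^sup>2"
    and "v \<equiv> - 200 * c - 80" and "e \<equiv> (7 + 5 * c + 88 * c\<^sup>2) / 40" and "e' \<equiv> (5 + 176 * c) / 40"
  shows "a * (e' + e\<^sup>2) + (2 * a * v + b) * e + 2 * c * v - b' < 0"
proof -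
  let ?P = "7744 * c^8 - 1345168 * c^7 - 11782743 * c^6 - 26434146 * c^5
    + 1046880 * c^4 + 30671466 * c^3 + 22975023 * c^2 + 6620448 * c + 684496"
  define r where "r = inverse (4 + c)"
  have r: "(4 + c) * r = 1" "r > 0" using assms(1) by (auto simp: r_def)
  have b: "b = - c + (1 - c\<^sup>2) * r" and b': "b' = - 1 - 2 * c * r - (1 - c\<^sup>2) * r\<^sup>2"
    by (simp_all add: b_def b'_def r_def divide_inverse power_inverse)
  define E E' where "E = 7 + 5 * c + 88 * c\<^sup>2" and "E' = 5 + 176 * c"
  have ee: "e = E / 40" "e' = E' / 40"
    by (simp_all add: e_def e'_def E_def E'_def)
  \<comment> \<open>The factor \<open>1600\<close> is the square of the denominator 40 in
    \<open>e\<close>. Multiplying further by \<open>(4 + c)\<^sup>2\<close> turns the expression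
    into \<open>- ?P\<close>.\<close>
  have "1600 * (a * (e' + e\<^sup>2) + (2 * a * v + b) * e + 2 * c * v - b')
      = a * (40 * E' + E\<^sup>2) + 40 * (2 * a * v + b) * E + 1600 * (2 * c * v - b')"
    unfolding ee by (simp add: power_divide algebra_simps)
  also have "\<dots> = - (?P * r\<^sup>2)"
    unfolding b b' a_def v_def E_def E'_def using r(1) by algebra
  also have "\<dots> < 0"
    using profile_polynomial_pos[of c] assms(1) r(2) by simp
  finally show ?thesis by simp
qed

section \<open>Construction of the pattern and count of its critical points\<close>

theorem theorem1p1:
  shows "\<exists>(f::real \<Rightarrow> real) (N::nat). f C1_differentiable_on UNIV \<and>
           (\<forall>n\<ge>N. \<exists>X U. torus_param X \<and> pattern f X U \<and>
              (\<exists>C. C \<subseteq> critical_points X U \<and> finite C \<and> card C \<ge> 4 * n))"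
proof -
  \<comment> \<open>\<open>V\<close> will be the derivative of the profile \<open>U\<close>: up to a
    constant factor the Gaussian \<open>exp (- 100 * (c + 2/5)\<^sup>2)\<close>. Its logarithmic
    derivative is \<open>v\<close>.\<close>
  define V where "V c = exp (- 100 * c\<^sup>2 - 80 * c)" for c :: real
  define v where "v c = - 200 * c - 80" for c :: real
  define b where "b c = - c + (1 - c\<^sup>2) / (4 + c)" for c :: real
  define b' where "b' c = - 1 - 2 * c / (4 + c) - (1 - c\<^sup>2) / (4 + c)\<^sup>2" for c :: real
  define e where "e c = (7 + 5 * c + 88 * c\<^sup>2) / 40" for c :: real
  define e' where "e' c = (5 + 176 * c) / 40" for c :: real
  \<comment> \<open>The exponent is an antiderivative of \<open>v + e\<close>.\<close>
  define \<phi> where "\<phi> c = exp (- 100 * c\<^sup>2 - 80 * c + (7 * c + 5 / 2 * c\<^sup>2 + 88 / 3 * c^3) / 40)" for c :: real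
  \<comment> \<open>Obtained by differentiating \<open>- zonal_LB c (V c) (v c * V c)\<close> and
    dividing by \<open>V c\<close>; this is the value that the derivative of \<open>f\<close> must
    take at \<open>U c\<close>.\<close>
  define q where "q c = - ((1 - c\<^sup>2) * (- 200 + (v c)\<^sup>2) + (- 2 * c + b c) * v c + b' c)" for c
  have dV: "(V has_real_derivative v c * V c) (at c)" for c
    unfolding V_def[abs_def] v_def by (auto intro!: derivative_eq_intros)
  have dv: "(v has_real_derivative - 200) (at c)" for c
    unfolding v_def[abs_def] by (auto intro!: derivative_eq_intros)
  have dV': "((\<lambda>c. v c * V c) has_real_derivative (- 200 + (v c)\<^sup>2) * V c) (at c)" for c
    by (rule DERIV_cong[OF DERIV_mult[OF dv dV]]) (simp add: algebra_simps power2_eq_square)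
  have de: "(e has_real_derivative e' c) (at c)" for c
    unfolding e_def[abs_def] e'_def by (auto intro!: derivative_eq_intros)
  have d\<phi>: "(\<phi> has_real_derivative (v c + e c) * \<phi> c) (at c)" for c
    unfolding \<phi>_def[abs_def] v_def e_def by (auto intro!: derivative_eq_intros simp: field_simps)
  have d\<phi>': "((\<lambda>c. (v c + e c) * \<phi> c) has_real_derivative (- 200 + e' c + (v c + e c)\<^sup>2) * \<phi> c) (at c)" for c
    by (rule DERIV_cong[OF DERIV_mult[OF DERIV_add[OF dv de] d\<phi>]]) (simp add: algebra_simps power2_eq_square)
  have db: "(b has_real_derivative b' c) (at c)" if "c \<in> {-1..1}" for c
  proof -
    have "4 + c \<noteq> 0" using that by auto
    then have "(b has_real_derivative - 1 + ((0 - 2 * c) * (4 + c) - (1 - c\<^sup>2) * 1) / ((4 + c) * (4 + c))) (at c)"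
      unfolding b_def[abs_def] by (auto intro!: derivative_eq_intros)
    then show ?thesis
      by (rule DERIV_cong) (use \<open>4 + c \<noteq> 0\<close> in \<open>simp add: b'_def diff_divide_distrib power2_eq_square\<close>)
  qed
  have contV: "continuous_on UNIV V" and cont\<phi>: "continuous_on UNIV \<phi>"
    using dV d\<phi> by (meson DERIV_isCont continuous_at_imp_continuous_on)+
  have contV': "continuous_on UNIV (\<lambda>c. v c * V c)"
    using dV' by (meson DERIV_isCont continuous_at_imp_continuous_on)
  have cont\<phi>'': "continuous_on UNIV (\<lambda>c. (- 200 + e' c + (v c + e c)\<^sup>2) * \<phi> c)"
    unfolding v_def e_def e'_def by (intro continuous_intros cont\<phi>) auto
  have Vpos: "V c > 0" and \<phi>pos: "\<phi> c > 0" for c by (simp_all add: V_def \<phi>_def)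
  obtain U where U: "\<And>c. (U has_real_derivative V c) (at c)"
    using antiderivative_exists[OF contV] by blast
  have dF: "((\<lambda>c. - zonal_LB c (V c) (v c * V c)) has_real_derivative q c * V c) (at c)" if "c \<in> {-1..1}" for c
  proof -
    have "((\<lambda>c. - ((1 - c\<^sup>2) * (v c * V c) + b c * V c)) has_real_derivative q c * V c) (at c)"
      unfolding q_def
      by (rule derivative_eq_intros dV dV' db[OF that] refl)+ (simp add: algebra_simps power2_eq_square)
    then show ?thesis by (simp add: zonal_LB_def b_def)
  qed
  have contq: "continuous_on {-1..1} q"
    unfolding q_def[abs_def] v_def b_def b'_def by (intro continuous_intros) auto
  obtain f g where f: "\<And>u. (f has_real_derivative g u) (at u)" "continuous_on UNIV g"
    and fU: "\<And>c. c \<in> {-1..1} \<Longrightarrow> f (U c) = - zonal_LB c (V c) (v c * V c)"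
    and gU: "\<And>c. c \<in> {-1..1} \<Longrightarrow> g (U c) = q c"
    using C1_factor_through_increasing[OF U Vpos dF contq] by blast
  have stat: "zonal_LB c (V c) (v c * V c) + f (U c) = 0" if "c \<in> {-1..1}" for c
    using fU[OF that] by simp
  have lin: "zonal_LB c ((v c + e c) * \<phi> c) ((- 200 + e' c + (v c + e c)\<^sup>2) * \<phi> c) + g (U c) * \<phi> c < 0"
    if "c \<in> {-1..1}" for c
  proof -
    \<comment> \<open>The terms with \<open>- 200\<close> and \<open>(v c)\<^sup>2\<close> cancel
      against those in \<open>q\<close>, leaving the expression of
      \<open>profile_linearization_neg\<close>.\<close>
    have "zonal_LB c ((v c + e c) * \<phi> c) ((- 200 + e' c + (v c + e c)\<^sup>2) * \<phi> c) + g (U c) * \<phi> c =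
      ((1 - c\<^sup>2) * (e' c + (e c)\<^sup>2) + (2 * (1 - c\<^sup>2) * v c + b c) * e c + 2 * c * v c - b' c) * \<phi> c"
      unfolding gU[OF that] q_def zonal_LB_def b_def[symmetric] by algebra
    also have "\<dots> < 0"
      using profile_linearization_neg[OF that] \<phi>pos unfolding b_def b'_def e_def e'_def v_def
      by (rule mult_neg_pos)
    finally show ?thesis .
  qed
  let ?U = "\<lambda>x. U (zonal_coord x)"
  have UX: "?U \<circ> ring_torus = (\<lambda>p. U (cos (2 * pi * fst p)))"
    by (auto simp: zonal_coord_ring_torus)
  note zonal = LB_ring_torus_zonal[OF U dV contV']
  have "stationary f ring_torus ?U"
    unfolding stationary_def UX
  proof (intro conjI allI)
    show "Ck 2 UNIV (\<lambda>p::real \<times> real. U (cos (2 * pi * fst p)))" by (rule zonal(1))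
    fix p :: "real \<times> real"
    show "LB ring_torus (\<lambda>p. U (cos (2 * pi * fst p))) p + f (U (zonal_coord (ring_torus p))) = 0"
      using zonal(4)[OF refl, of "fst p" "snd p"] stat[of "cos (2 * pi * fst p)"]
      by (simp add: zonal_coord_ring_torus)
  qed
  moreover have "stable f ring_torus ?U"
    by (rule stable_zonal[OF U dV contV' d\<phi> d\<phi>' cont\<phi>'' f \<phi>pos stat lin])
  moreover have "\<exists>x\<in>range ring_torus. \<exists>y\<in>range ring_torus. ?U x \<noteq> ?U y"
  proof (intro bexI)
    have "U (-1) < U 1"
    proof (rule DERIV_pos_imp_increasing[of "- 1" 1 U])
      show "\<exists>y. (U has_real_derivative y) (at c) \<and> 0 < y" for c
        using U[of c] Vpos[of c] by blast
    qed simp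
    \<comment> \<open>The two points lie on the inner and outer equators, where \<open>c\<close>
      equals -1 and 1.\<close>
    then show "?U (ring_torus (1/2, 0)) \<noteq> ?U (ring_torus (0, 0))"
      by (simp add: zonal_coord_ring_torus)
  qed auto
  ultimately have pattern: "pattern f ring_torus ?U"
    by (simp add: pattern_def)
  have crit: "\<exists>C. C \<subseteq> critical_points ring_torus ?U \<and> finite C \<and> card C \<ge> 4 * n" for n
  proof (intro exI conjI)
    \<comment> \<open>Equally spaced points on the outer equator \<open>s = 0\<close>, where the
      factor \<open>sin (2 * pi * s)\<close> annihilates the latitudinal derivative.\<close>
    let ?x = "\<lambda>i. ring_torus (0, real i / real (4 * n))"
    let ?C = "?x ` {..<4 * n}"
    have "inj_on ?x {..<4 * n}"
    proof (rule inj_onI)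
      fix i j assume ij: "i \<in> {..<4 * n}" "j \<in> {..<4 * n}" and "?x i = ?x j"
      then have "real i / real (4 * n) - real j / real (4 * n) \<in> \<int>"
        using ring_torus_eqD(2)[of "(0, real i / real (4 * n))" "(0, real j / real (4 * n))"] by simp
      then obtain k :: int where k: "real i / real (4 * n) - real j / real (4 * n) = k"
        by (auto elim: Ints_cases)
      have "0 \<le> real i / real (4 * n)" "real i / real (4 * n) < 1"
        "0 \<le> real j / real (4 * n)" "real j / real (4 * n) < 1"
        using ij by auto
      \<comment> \<open>Both parameters lie in one period \<open>[0, 1)\<close>, so their integer
        difference must be 0.\<close>
      then have "\<bar>real_of_int k\<bar> < 1" using k by linarith
      then have "k = 0" by linarith
      then show "i = j" using k ij by (auto simp: field_simps)
    qed
    then show "4 * n \<le> card ?C" by (simp add: card_image)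
    show "?C \<subseteq> critical_points ring_torus ?U"
    proof
      fix x assume "x \<in> ?C"
      then obtain i where "x = ring_torus (0, real i / real (4 * n))" by blast
      moreover have "pd 0 (?U \<circ> ring_torus) (0, t) = 0" "pd 1 (?U \<circ> ring_torus) (0, t) = 0" for t
        unfolding UX zonal(2,3) by simp_all
      ultimately show "x \<in> critical_points ring_torus ?U"
        unfolding critical_points_def by blast
    qed
  qed simp
  have "f C1_differentiable_on UNIV"
    using f unfolding C1_differentiable_on_def has_real_derivative_iff_has_vector_derivative by auto
  moreover have "\<exists>X U. torus_param X \<and> pattern f X U \<and>
      (\<exists>C. C \<subseteq> critical_points X U \<and> finite C \<and> card C \<ge> 4 * n)" for n
    by (rule exI[of _ ring_torus], rule exI[of _ ?U])
      (rule conjI[OF torus_param_ring_torus conjI[OF pattern crit]])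
  ultimately show ?thesis by blast
qed

end
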